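(* Let $A\in\mathbb R^{p\times m}$ and $b\in\mathbb R^p$ be the balance-plus-normalisation matrix and right-hand side defined in the context, $M=\{x\in\mathbb R^m: Ax=b\}$, and let $\bar x\in\mathbb R^m$ be a reference vector. (a) For the Euclidean divergence $D(x,\bar x)=\|x-\bar x\|^2$, the minimiser $x=\arg\min_{Ax=b}D(x,\bar x)$ is the orthogonal projection of $\bar x$ onto $M$, $$x=\bar x-A^{\top}(AA^{\top})^{-1}(A\bar x-b).$$ For $\bar x=0$ it is the minimum-norm point of the affine space $M$, and this point coincides with the normal solution (the minimum-Euclidean-norm element) of the polytope $M_0=M\cap\mathbb R^m_+$ when that point is feasible, i.e. componentwise non-negative. (b) Assume $\bar x>0$ componentwise and that $M\cap\mathbb R^m_+\ne\varnothing$, and let $D(x,\bar x)=\sum_j\bigl(x_j\log(x_j/\bar x_j)-x_j+\bar x_j\bigr)$ for $x\in\mathbb R^m_+$ (with $0\log 0=0$). Then the $I$-projection of $\bar x$ onto $M\cap\mathbb R^m_+$, i.e. the minimiser of $D(\cdot,\bar x)$ over $M\cap\mathbb R^m_+$, exists and is unique. If moreover $M\cap\operatorname{relint}\Delta\neq\varnothing$, then this minimiser has the exponential form $x_j=\bar x_j\exp\bigl((A^{\top}\nu)_j\bigr)$ for all $j$ with some finite $\nu\in\mathbb R^p$, and it is the limit of the alternating (cyclic) Bregman projections, with respect to this divergence and started at $\bar x$, onto the constraint blocks. If $\bar x$ is uniform (all components equal), the minimiser is the maximum-entropy operator, i.e. the maximiser of $-\sum_j x_j\log x_j$ over $M\cap\mathbb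 R^m_+$. In both cases the recovered point is the Bregman projection of $\bar x$ onto $M$ for the chosen divergence (in (b), onto the part of $M$ in the domain $\mathbb R^m_+$ of the divergence).
   Context: $\Delta\subset\mathbb R^m_+$ is the product of the source outflow simplices, that is, the set of all $x\ge0$ satisfying the $2n+1$ normalisation equations listed below. The constraint blocks are affine sets, each cut out by one block of the constraints, with intersection $M$: the source normalisation equations and the target balance equations, where the balance equation of a target cluster is combined with the normalisation of the same cluster as a source, so that it becomes the inflow (column-sum) equation "sum over sources $s$ with a component leading into that target, retention included, of (mass of $s$)$\,\times\,$(that component) $=$ count of the target at time $t+1$" (the reserve source having mass $N_{\mathrm{eff}}^{(0)}$ below). The Bregman projection of $\bar x$ onto a set for the divergence $D$ is the minimiser of $D(\cdot,\bar x)$ over that set; the two divergences are the Bregman divergences of $\|x\|^2$ and of $\sum_j (x_j\log x_j-x_j)$. Fix an integer $n\ge 1$ and an instant $t$. The data are: counts at time $t$, $N_1^{(i)}(t)>0$ for $i=1,\dots,n$ (active clusters) and $N_2^{(i)}(t)>0$ for $i=0,\dots,n$ (passive clusters; index $0$ is the reserve); nonnegative counts $N_1^{(i)}(t+1)$, $N_2^{(i)}(t+1)$ at time $t+1$; and an exogenous inflow $\Delta N_2^{(0)}(t)\ge 0$. Put $N_{\mathrm{eff}}^{(0)}=\Delta N_2^{(0)}(t)+N_2^{(0)}(t)$. The unknown vector $x\in\mathbb R^m$, $m=2n^2+5n+2$, has the components $P_{11}^{(i,j)}$ ($1\le i\le n$, $j\in\{1,\dots,n+1\}\setminus\{i\}$;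 move active $i$ to active $j$), $P_{12}^{(i)}$ ($1\le i\le n$; active $i$ to passive $i$), $P_{21}^{(i,j)}$ ($0\le i\le n$, $1\le j\le n+1$; passive $i$ to active $j$), $P^{*(i)}$ ($0\le i\le n$; retention of passive $i$), $P^{**(i)}$ ($1\le i\le n$; retention of active $i$); the destination index $j=n+1$ means departure from the system. With $p=4n+2$, the matrix $A\in\mathbb R^{p\times m}$ and vector $b\in\mathbb R^p$ are defined by declaring $Ax=b$ to be the following system of $p$ linear equations. Balance equations ($2n+1$ of them): for $i=1,\dots,n$, $$\sum_{j=1}^n N_2^{(j)}(t)P_{21}^{(j,i)}+N_{\mathrm{eff}}^{(0)}P_{21}^{(0,i)}+\sum_{j\le n,\,j\ne i}N_1^{(j)}(t)P_{11}^{(j,i)}-N_1^{(i)}(t)\Bigl[P_{12}^{(i)}+\sum_{j\le n+1,\,j\neq i}P_{11}^{(i,j)}\Bigr]=N_1^{(i)}(t+1)-N_1^{(i)}(t);$$ $$-N_{\mathrm{eff}}^{(0)}\sum_{j=1}^{n+1}P_{21}^{(0,j)}=N_2^{(0)}(t+1)-N_2^{(0)}(t)-\Delta N_2^{(0)}(t);$$ and for $i=1,\dots,n$, $\;N_1^{(i)}(t)P_{12}^{(i)}-N_2^{(i)}(t)\sum_{j=1}^{n+1}P_{21}^{(i,j)}=N_2^{(i)}(t+1)-N_2^{(i)}(t)$. Normalisation equations ($2n+1$ of them): $P_{12}^{(i)}+\sum_{j\le n+1,\,j\ne i}P_{11}^{(i,j)}+P^{**(i)}=1$ for $i=1,\dots,n$,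 and $\sum_{j=1}^{n+1}P_{21}^{(i,j)}+P^{*(i)}=1$ for $i=0,\dots,n$. *)

theory Defs
  imports "HOL-Analysis.Analysis"
begin

text \<open>
  The integer \<open>n \<ge> 1\<close> is \<open>CARD('n)\<close> for a finite type \<open>'n\<close> of cluster labels.  The passive indices
  \<open>0, \<dots>, n\<close> are \<open>'n option\<close> with \<open>None\<close> the reserve \<open>0\<close>; the destinations \<open>1, \<dots>, n + 1\<close> are also
  \<open>'n option\<close>, there with \<open>None\<close> the departure \<open>n + 1\<close>.
\<close>

typedef 'n move = "{(i :: 'n, j :: 'n option). j \<noteq> Some i}"
  by auto

instance move :: (finite) finite
proof
  have "finite (Rep_move ` (UNIV :: 'a move set))"
    by (rule finite)
  then show "finite (UNIV :: 'a move set)"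
    by (rule finite_imageD) (simp add: Rep_move_inject inj_on_def)
qed

datatype 'n component =
    P11_move "'n move"
  | P12 'n
  | P21 "'n option" "'n option"
  | Pret_passive "'n option"
  | Pret_active 'n

text \<open>
  \<open>Pret_passive\<close> and \<open>Pret_active\<close> are the retentions \<open>P\<^sup>*\<close> and \<open>P\<^sup>*\<^sup>*\<close>.
  The abbreviation \<open>P11 i j\<close> is only meaningful for \<open>j \<noteq> Some i\<close>.
\<close>

abbreviation P11 :: "'n \<Rightarrow> 'n option \<Rightarrow> 'n component" where
  "P11 i j \<equiv> P11_move (Abs_move (i, j))"

lemma UNIV_component:
  "(UNIV :: 'n component set) = range P11_move \<union> range P12 \<union> range (\<lambda>(i, j). P21 i j)
    \<union> range Pret_passive \<union> range Pret_active"
  (is "_ = ?R")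
proof -
  have "c \<in> ?R" for c :: "'n component"
    by (cases c) auto
  then show ?thesis by blast
qed

instance component :: (finite) finite
  by standard (simp add: UNIV_component)

datatype 'n equation =
    Bal_active 'n
  | Bal_reserve
  | Bal_passive 'n
  | Norm_active 'n
  | Norm_passive "'n option"

lemma UNIV_equation:
  "(UNIV :: 'n equation set) = range Bal_active \<union> {Bal_reserve} \<union> range Bal_passive
    \<union> range Norm_active \<union> range Norm_passive"
  (is "_ = ?R")
proof -
  have "e \<in> ?R" for e :: "'n equation"
    by (cases e) auto
  then show ?thesis by blast
qed

instance equation :: (finite) finite
  by standard (simp add: UNIV_equation)

lemma card_move: "CARD('n::finite move) = CARD('n) * CARD('n)"
proof -
  have "CARD('n move) = card (range (Rep_move :: 'n move \<Rightarrow> _))"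
    by (rule card_image[symmetric]) (simp add: Rep_move_inject inj_on_def)
  also have "range (Rep_move :: 'n move \<Rightarrow> _) = (SIGMA i:UNIV. - {Some i})"
    unfolding type_definition.Rep_range[OF type_definition_move] by auto
  also have "card \<dots> = CARD('n) * CARD('n)"
    by (subst card_SigmaI) (simp_all add: card_Diff_subset Compl_eq_Diff_UNIV)
  finally show ?thesis .
qed

lemma card_component:
  "CARD('n::finite component) = 2 * CARD('n)\<^sup>2 + 5 * CARD('n) + 2"
proof -
  have inj: "inj P11_move" "inj P12" "inj (\<lambda>(i, j). P21 i j)" "inj Pret_passive" "inj Pret_active"
    by (auto simp: inj_on_def)
  have "CARD('n component) = CARD('n move) + CARD('n) + CARD('n option \<times> 'n option)
      + CARD('n option) + CARD('n)"
    unfolding UNIV_component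
    by (subst card_Un_disjoint, (simp; fail), (simp; fail), (force; fail))+
      (simp only: card_image[OF inj(1)] card_image[OF inj(2)] card_image[OF inj(3)]
        card_image[OF inj(4)] card_image[OF inj(5)] UNIV_Times_UNIV)
  then show ?thesis
    by (simp add: card_move power2_eq_square card_prod)
qed

lemma card_equation: "CARD('n::finite equation) = 4 * CARD('n) + 2"
proof -
  have inj: "inj Bal_active" "inj Bal_passive" "inj Norm_active" "inj Norm_passive"
    by (auto simp: inj_on_def)
  show ?thesis
    unfolding UNIV_equation
    by (subst card_Un_disjoint, (simp; fail), (simp; fail), (force; fail))+
      (simp add: card_image[OF inj(1)] card_image[OF inj(2)] card_image[OF inj(3)]
        card_image[OF inj(4)])
qed

text \<open>Counts at the fixed instant \<open>t\<close>, counts at \<open>t + 1\<close> (primed), and the exogenous inflow.\<close>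

record 'n cluster_data =
  N1 :: "'n \<Rightarrow> real"
  N2 :: "'n option \<Rightarrow> real"
  N1' :: "'n \<Rightarrow> real"
  N2' :: "'n option \<Rightarrow> real"
  inflow :: real

definition valid_data :: "'n cluster_data \<Rightarrow> bool" where
  "valid_data d \<longleftrightarrow> (\<forall>i. 0 < N1 d i) \<and> (\<forall>i. 0 < N2 d i) \<and>
     (\<forall>i. 0 \<le> N1' d i) \<and> (\<forall>i. 0 \<le> N2' d i) \<and> 0 \<le> inflow d"

definition Neff :: "'n cluster_data \<Rightarrow> real" where
  "Neff d = inflow d + N2 d None"

fun lhs :: "'n::finite cluster_data \<Rightarrow> real ^ 'n component \<Rightarrow> 'n equation \<Rightarrow> real" where
  "lhs d x (Bal_active i) =
     (\<Sum>j\<in>UNIV. N2 d (Some j) * x $ P21 (Some j) (Some i)) + Neff d * x $ P21 None (Some i)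
     + (\<Sum>j\<in>UNIV - {i}. N1 d j * x $ P11 j (Some i))
     - N1 d i * (x $ P12 i + (\<Sum>j\<in>UNIV - {Some i}. x $ P11 i j))"
| "lhs d x Bal_reserve = - Neff d * (\<Sum>j\<in>UNIV. x $ P21 None j)"
| "lhs d x (Bal_passive i) =
     N1 d i * x $ P12 i - N2 d (Some i) * (\<Sum>j\<in>UNIV. x $ P21 (Some i) j)"
| "lhs d x (Norm_active i) =
     x $ P12 i + (\<Sum>j\<in>UNIV - {Some i}. x $ P11 i j) + x $ Pret_active i"
| "lhs d x (Norm_passive i) = (\<Sum>j\<in>UNIV. x $ P21 i j) + x $ Pret_passive i"

fun rhs :: "'n cluster_data \<Rightarrow> 'n equation \<Rightarrow> real" where
  "rhs d (Bal_active i) = N1' d i - N1 d i"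
| "rhs d Bal_reserve = N2' d None - N2 d None - inflow d"
| "rhs d (Bal_passive i) = N2' d (Some i) - N2 d (Some i)"
| "rhs d (Norm_active i) = 1"
| "rhs d (Norm_passive i) = 1"

definition A_mat :: "'n::finite cluster_data \<Rightarrow> real ^ 'n component ^ 'n equation" where
  "A_mat d = matrix (\<lambda>x. \<chi> e. lhs d x e)"

definition b_vec :: "'n::finite cluster_data \<Rightarrow> real ^ 'n equation" where
  "b_vec d = (\<chi> e. rhs d e)"

lemma linear_lhs: "linear (\<lambda>x :: real ^ 'n::finite component. \<chi> e. lhs d x e)"
proof (rule linearI)
  fix x y :: "real ^ 'n component" and c :: real
  have "lhs d (x + y) e = lhs d x e + lhs d y e" for e
    by (cases e) (simp_all add: sum.distrib algebra_simps)
  then show "(\<chi> e. lhs d (x + y) e) = (\<chi> e. lhs d x e) + (\<chi> e. lhs d y e)"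
    by (simp add: vec_eq_iff)
  have "lhs d (c *\<^sub>R x) e = c * lhs d x e" for e
    by (cases e) (simp_all add: sum_distrib_left algebra_simps)
  then show "(\<chi> e. lhs d (c *\<^sub>R x) e) = c *\<^sub>R (\<chi> e. lhs d x e)"
    by (simp add: vec_eq_iff)
qed

lemma A_mat_mult_eq_iff: "A_mat d *v x = b_vec d \<longleftrightarrow> (\<forall>e. lhs d x e = rhs d e)"
  unfolding A_mat_def matrix_works[OF linear_lhs[folded linear_matrix_vector_mul_eq]]
  by (simp add: b_vec_def vec_eq_iff)

definition M_set :: "'n::finite cluster_data \<Rightarrow> (real ^ 'n component) set" where
  "M_set d = {x. A_mat d *v x = b_vec d}"

definition nonneg :: "(real ^ 'k) set" where
  "nonneg = {x. \<forall>j. 0 \<le> x $ j}"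

definition source_block :: "'n::finite cluster_data \<Rightarrow> (real ^ 'n component) set" where
  "source_block d =
     {x. (\<forall>i. lhs d x (Norm_active i) = 1) \<and> (\<forall>i. lhs d x (Norm_passive i) = 1)}"

text \<open>Each balance equation plus the mass of its cluster times the cluster's own normalisation.\<close>

definition target_block :: "'n::finite cluster_data \<Rightarrow> (real ^ 'n component) set" where
  "target_block d =
     {x. (\<forall>i. (\<Sum>j\<in>UNIV. N2 d (Some j) * x $ P21 (Some j) (Some i))
              + Neff d * x $ P21 None (Some i)
              + (\<Sum>j\<in>UNIV - {i}. N1 d j * x $ P11 j (Some i))
              + N1 d i * x $ Pret_active i = N1' d i) \<and>
         (\<forall>i. N1 d i * x $ P12 i + N2 d (Some i) * x $ Pret_passive (Some i) = N2' d (Some i)) \<and>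
         Neff d * x $ Pret_passive None = N2' d None}"

lemma source_Int_target: "source_block d \<inter> target_block d = M_set d"
proof -
  have "x \<in> target_block d \<longleftrightarrow> x \<in> M_set d" if x: "x \<in> source_block d" for x
  proof -
    have act: "x $ P12 i + (\<Sum>j\<in>UNIV - {Some i}. x $ P11 i j) = 1 - x $ Pret_active i" for i
      using x by (simp add: source_block_def algebra_simps)
    have pas: "(\<Sum>j\<in>UNIV. x $ P21 i j) = 1 - x $ Pret_passive i" for i
      using x by (simp add: source_block_def algebra_simps)
    have split: "(\<forall>e. Q e) \<longleftrightarrow> (\<forall>i. Q (Bal_active i)) \<and> Q Bal_reserve \<and> (\<forall>i. Q (Bal_passive i))
        \<and> (\<forall>i. Q (Norm_active i)) \<and> (\<forall>i. Q (Norm_passive i))" for Q :: "'a equation \<Rightarrow> bool"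
      by (metis equation.exhaust)
    have norm: "\<forall>i. lhs d x (Norm_active i) = 1" "\<forall>i. lhs d x (Norm_passive i) = 1"
      using x by (auto simp: source_block_def)
    have e1: "lhs d x (Bal_active i) = rhs d (Bal_active i) \<longleftrightarrow>
        (\<Sum>j\<in>UNIV. N2 d (Some j) * x $ P21 (Some j) (Some i)) + Neff d * x $ P21 None (Some i)
        + (\<Sum>j\<in>UNIV - {i}. N1 d j * x $ P11 j (Some i)) + N1 d i * x $ Pret_active i = N1' d i" for i
      unfolding lhs.simps rhs.simps act by (simp add: algebra_simps)
    have e2: "lhs d x Bal_reserve = rhs d Bal_reserve \<longleftrightarrow>
        Neff d * x $ Pret_passive None = N2' d None"
      unfolding lhs.simps rhs.simps pas by (simp add: Neff_def algebra_simps)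
    have e3: "lhs d x (Bal_passive i) = rhs d (Bal_passive i) \<longleftrightarrow>
        N1 d i * x $ P12 i + N2 d (Some i) * x $ Pret_passive (Some i) = N2' d (Some i)" for i
      unfolding lhs.simps rhs.simps pas by (simp add: algebra_simps)
    show ?thesis
      unfolding M_set_def target_block_def mem_Collect_eq A_mat_mult_eq_iff split e1 e2 e3
      using norm by (auto simp del: lhs.simps)
  qed
  moreover have "M_set d \<subseteq> source_block d"
    by (auto simp: M_set_def source_block_def A_mat_mult_eq_iff simp del: lhs.simps)
  ultimately show ?thesis by blast
qed

definition Delta :: "'n::finite cluster_data \<Rightarrow> (real ^ 'n component) set" where
  "Delta d = nonneg \<inter> source_block d"

definition unique_arg_min :: "('a \<Rightarrow> real) \<Rightarrow> 'a set \<Rightarrow> 'a \<Rightarrow> bool" where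
  "unique_arg_min f K x \<longleftrightarrow> (\<forall>z. is_arg_min f (\<lambda>z. z \<in> K) z \<longleftrightarrow> z = x)"

definition unique_arg_max :: "('a \<Rightarrow> real) \<Rightarrow> 'a set \<Rightarrow> 'a \<Rightarrow> bool" where
  "unique_arg_max f K x \<longleftrightarrow> (\<forall>z. is_arg_max f (\<lambda>z. z \<in> K) z \<longleftrightarrow> z = x)"

definition orthogonal_projection :: "'a::real_inner set \<Rightarrow> 'a \<Rightarrow> 'a \<Rightarrow> bool" where
  "orthogonal_projection K y x \<longleftrightarrow> x \<in> K \<and> (\<forall>z\<in>K. orthogonal (y - x) (z - x))"

definition bregman_divergence :: "('a::real_normed_vector \<Rightarrow> real) \<Rightarrow> 'a \<Rightarrow> 'a \<Rightarrow> real" where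
  "bregman_divergence \<phi> x y = \<phi> x - \<phi> y - frechet_derivative \<phi> (at y) (x - y)"

definition bregman_projection :: "('a \<Rightarrow> 'a \<Rightarrow> real) \<Rightarrow> 'a set \<Rightarrow> 'a \<Rightarrow> 'a \<Rightarrow> bool" where
  "bregman_projection D K y x \<longleftrightarrow> unique_arg_min (\<lambda>z. D z y) K x"

text \<open>At most one \<open>X\<close> satisfies this, since each projection is by definition a unique minimiser.\<close>

definition cyclic_projections ::
    "('a \<Rightarrow> 'a \<Rightarrow> real) \<Rightarrow> 'a set list \<Rightarrow> 'a \<Rightarrow> (nat \<Rightarrow> 'a) \<Rightarrow> bool" where
  "cyclic_projections D Ks y X \<longleftrightarrow>
     X 0 = y \<and> (\<forall>k. bregman_projection D (Ks ! (k mod length Ks)) (X k) (X (Suc k)))"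

definition euclid_div :: "real ^ 'k \<Rightarrow> real ^ 'k \<Rightarrow> real" where
  "euclid_div x y = (norm (x - y))\<^sup>2"

text \<open>
  In the next three definitions \<open>ln 0 = 0\<close> yields the convention \<open>0 log 0 = 0\<close>.  The divergence is
  the intended one only for \<open>x \<ge> 0\<close> and \<open>y > 0\<close> componentwise.
\<close>

definition I_div :: "real ^ 'k \<Rightarrow> real ^ 'k \<Rightarrow> real" where
  "I_div x y = (\<Sum>j\<in>UNIV. x $ j * ln (x $ j / y $ j) - x $ j + y $ j)"

definition neg_entropy :: "real ^ 'k \<Rightarrow> real" where
  "neg_entropy x = (\<Sum>j\<in>UNIV. x $ j * ln (x $ j) - x $ j)"

definition entropy :: "real ^ 'k \<Rightarrow> real" where
  "entropy x = - (\<Sum>j\<in>UNIV. x $ j * ln (x $ j))"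

end

theory Submission
  imports Defs "HOL-Real_Asymp.Real_Asymp"
begin

text \<open>
  Departures and retentions alone already make \<open>A\<close> surjective, so \<open>A A\<^sup>T\<close> is invertible and (a) is
  the normal-equation formula.  For (b), the I-divergence dominates
  \<open>\<Sum>j. (\<surd>(x j) - \<surd>(y j))\<^sup>2\<close>, which gives coercivity, hence existence of projections, and, through
  the midpoint, their uniqueness.  If a constraint set contains a positive point, its projection is
  positive, because the slope of \<open>t ln t\<close> at \<open>0\<close> is \<open>-\<infinity>\<close>; stationarity then says that
  \<open>ln (x / xbar)\<close> is orthogonal to the kernel of \<open>A\<close>, that is, in the range of \<open>A\<^sup>T\<close>.  Stationarity
  and the three-point identity yield the Pythagorean identity, from which the cyclic projections
  converge.
\<close>

section \<open>Projection onto the solution set of a linear system of full row rank\<close>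

lemma unique_arg_minI:
  assumes "x \<in> K" "\<And>z. z \<in> K \<Longrightarrow> f x \<le> f z" "\<And>z. z \<in> K \<Longrightarrow> f z \<le> f x \<Longrightarrow> z = x"
  shows "unique_arg_min f K x"
  unfolding unique_arg_min_def is_arg_min_linorder using assms by blast

lemma unique_arg_min_le: "unique_arg_min f K x \<Longrightarrow> z \<in> K \<Longrightarrow> f x \<le> f z"
  and unique_arg_min_mem: "unique_arg_min f K x \<Longrightarrow> x \<in> K"
  and unique_arg_min_eq: "unique_arg_min f K x \<Longrightarrow> z \<in> K \<Longrightarrow> f z \<le> f x \<Longrightarrow> z = x"
  unfolding unique_arg_min_def is_arg_min_linorder by (blast intro: order_trans)+

lemma unique_arg_min_cong:
  assumes "\<And>z. z \<in> K \<Longrightarrow> f z = g z"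
  shows "unique_arg_min f K x \<longleftrightarrow> unique_arg_min g K x"
proof -
  have "is_arg_min f (\<lambda>z. z \<in> K) z \<longleftrightarrow> is_arg_min g (\<lambda>z. z \<in> K) z" for z
    unfolding is_arg_min_linorder using assms by auto
  then show ?thesis by (simp add: unique_arg_min_def)
qed

section \<open>Gram matrices, the range of the transpose and orthogonal projections\<close>

lemma inner_transpose_mult:
  fixes A :: "real ^ 'm ^ 'p"
  shows "inner (transpose A *v \<mu>) x = inner \<mu> (A *v x)"
  by (simp add: dot_lmul_matrix)

text \<open>If A A^T v = 0, then |A^T v|^2 = 0, so A^T v = 0; writing v as A x gives <v, v> = <A^T
  v, x> = 0.\<close>

lemma gram_invertible:
  fixes A :: "real ^ 'm ^ 'p"
  assumes "surj ((*v) A)"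
  shows "invertible (A ** transpose A)"
proof -
  have "v = 0" if "(A ** transpose A) *v v = 0" for v
  proof -
    have "inner (transpose A *v v) (transpose A *v v) = 0"
      using that by (simp only: inner_transpose_mult matrix_vector_mul_assoc) simp
    then have 0: "transpose A *v v = 0" by simp
    obtain x where "A *v x = v" using assms by (metis surjD)
    then have "inner v v = inner (transpose A *v v) x" by (simp only: inner_transpose_mult)
    then show "v = 0" using 0 by simp
  qed
  then show ?thesis
    unfolding invertible_left_inverse matrix_left_invertible_ker by blast
qed

lemma gram_mult_inv:
  fixes A :: "real ^ 'm ^ 'p"
  assumes "invertible (A ** transpose A)"
  shows "A *v (transpose A *v (matrix_inv (A ** transpose A) *v w)) = w"
proof -
  have "(A ** transpose A) ** matrix_inv (A ** transpose A) = mat 1"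
    using assms unfolding invertible_def matrix_inv_def by (rule someI2_ex) simp
  then show ?thesis
    by (simp only: matrix_vector_mul_assoc matrix_mul_assoc matrix_vector_mul_lid)
qed

text \<open>Subtracting from \<open>w\<close> its orthogonal projection onto the range of A^T leaves
  a kernel vector orthogonal to itself. This later supplies the multiplier of the exponential
  form.\<close>

lemma orthogonal_kernel_imp_range_transpose:
  fixes A :: "real ^ 'm ^ 'p"
  assumes inv: "invertible (A ** transpose A)"
    and perp: "\<And>h. A *v h = 0 \<Longrightarrow> inner w h = 0"
  shows "\<exists>\<nu>. w = transpose A *v \<nu>"
proof -
  define \<nu> where "\<nu> = matrix_inv (A ** transpose A) *v (A *v w)"
  define h where "h = w - transpose A *v \<nu>"
  have ker: "A *v h = 0"
    using gram_mult_inv[OF inv, of "A *v w"]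
    by (simp only: h_def \<nu>_def matrix_vector_mult_diff_distrib) simp
  have "inner h h = inner w h - inner \<nu> (A *v h)"
    by (simp only: h_def inner_diff_left inner_transpose_mult[symmetric])
  then have "h = 0" using perp[OF ker] ker by simp
  then show ?thesis unfolding h_def by (intro exI[of _ \<nu>]) simp
qed

text \<open>The correction lies in the range of A^T, which is orthogonal to the kernel of
  \<open>A\<close>, and differences of solutions lie in that kernel.\<close>

lemma orthogonal_projection_gram:
  fixes A :: "real ^ 'm ^ 'p"
  assumes inv: "invertible (A ** transpose A)"
  shows "orthogonal_projection {x. A *v x = b} y
    (y - transpose A *v (matrix_inv (A ** transpose A) *v (A *v y - b)))"
  unfolding orthogonal_projection_def orthogonal_def
proof (intro conjI ballI)
  let ?\<mu> = "matrix_inv (A ** transpose A) *v (A *v y - b)"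
  have 1: "A *v (y - transpose A *v ?\<mu>) = b"
    by (simp only: matrix_vector_mult_diff_distrib gram_mult_inv[OF inv]) simp
  then show "y - transpose A *v ?\<mu> \<in> {x. A *v x = b}" by blast
  fix z assume "z \<in> {x. A *v x = b}"
  then have "A *v (z - (y - transpose A *v ?\<mu>)) = 0"
    using 1 by (simp only: matrix_vector_mult_diff_distrib mem_Collect_eq) simp
  then have "inner (transpose A *v ?\<mu>) (z - (y - transpose A *v ?\<mu>)) = 0"
    by (simp only: inner_transpose_mult inner_zero_right)
  then show "inner (y - (y - transpose A *v ?\<mu>)) (z - (y - transpose A *v ?\<mu>)) = 0"
    by simp
qed

text \<open>Pythagoras: the squared distance from \<open>z\<close> to \<open>y\<close> exceeds that
  from \<open>x\<close> to \<open>y\<close> by |z - x|^2, which gives minimality and uniqueness at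
  once.\<close>

lemma orthogonal_projection_unique_arg_min:
  assumes "orthogonal_projection K y x"
  shows "unique_arg_min (\<lambda>z. (norm (z - y))\<^sup>2) K x"
proof -
  have pyth: "(norm (z - y))\<^sup>2 = (norm (z - x))\<^sup>2 + (norm (x - y))\<^sup>2" if "z \<in> K" for z
  proof -
    have "inner (y - x) (z - x) = 0"
      using assms that by (auto simp: orthogonal_projection_def orthogonal_def)
    then show ?thesis
      unfolding power2_norm_eq_inner by (simp add: algebra_simps inner_commute)
  qed
  show ?thesis
  proof (rule unique_arg_minI)
    show x: "x \<in> K" using assms by (simp add: orthogonal_projection_def)
    fix z assume z: "z \<in> K"
    show "(norm (x - y))\<^sup>2 \<le> (norm (z - y))\<^sup>2" using pyth[OF z] by simp
    show "z = x" if "(norm (z - y))\<^sup>2 \<le> (norm (x - y))\<^sup>2"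
      using pyth[OF z] that by simp
  qed
qed

lemma bregman_divergence_norm_power2:
  fixes x y :: "'a::real_inner"
  shows "bregman_divergence (\<lambda>z. (norm z)\<^sup>2) x y = (norm (x - y))\<^sup>2"
proof -
  have "((\<lambda>z. (norm z)\<^sup>2) has_derivative (\<lambda>h. 2 * inner y h)) (at y)"
    unfolding power2_norm_eq_inner
    by (rule derivative_eq_intros refl | simp add: inner_commute)+
  from frechet_derivative_at[OF this, symmetric] show ?thesis
    unfolding bregman_divergence_def power2_norm_eq_inner
    by (simp add: algebra_simps inner_commute)
qed

section \<open>The I-divergence\<close>

text \<open>This is ln s <= s - 1 at s = sqrt (y / x), multiplied by 2 x. The left side is a term of
  the squared Hellinger distance, up to normalisation.\<close>

lemma I_div_term_ge:
  fixes x y :: real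
  assumes "0 \<le> x" "0 < y"
  shows "(sqrt x - sqrt y)\<^sup>2 \<le> x * ln (x / y) - x + y"
proof (cases "x = 0")
  case True
  then show ?thesis using assms by simp
next
  case False
  then have x: "0 < x" using assms by simp
  have "ln (x / y) = - 2 * ln (sqrt (y / x))"
    using x assms by (simp add: ln_sqrt ln_div)
  moreover have "ln (sqrt (y / x)) \<le> sqrt (y / x) - 1"
    using x assms by (intro ln_le_minus_one) simp
  ultimately have "2 - 2 * sqrt (y / x) \<le> ln (x / y)" by simp
  then have "x * (2 - 2 * sqrt (y / x)) \<le> x * ln (x / y)"
    using x by (intro mult_left_mono) auto
  moreover have "x * sqrt (y / x) = sqrt x * sqrt y"
  proof -
    have "x * sqrt (y / x) = (sqrt x * sqrt x) * (sqrt y / sqrt x)"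
      using x by (simp add: real_sqrt_divide)
    also have "\<dots> = sqrt x * sqrt y" using x by (simp add: field_simps)
    finally show ?thesis .
  qed
  ultimately show ?thesis using x assms
    by (simp add: power2_diff algebra_simps)
qed

lemma I_div_ge:
  fixes x y :: "real ^ 'k::finite"
  assumes "x \<in> nonneg" "\<And>j. 0 < y $ j"
  shows "(\<Sum>j\<in>UNIV. (sqrt (x $ j) - sqrt (y $ j))\<^sup>2) \<le> I_div x y"
  unfolding I_div_def using assms by (intro sum_mono I_div_term_ge) (auto simp: nonneg_def)

lemma I_div_ge_component:
  fixes x y :: "real ^ 'k::finite"
  assumes "x \<in> nonneg" "\<And>j. 0 < y $ j"
  shows "(sqrt (x $ j) - sqrt (y $ j))\<^sup>2 \<le> I_div x y"
proof -
  have "(sqrt (x $ j) - sqrt (y $ j))\<^sup>2 \<le> (\<Sum>j\<in>UNIV. (sqrt (x $ j) - sqrt (y $ j))\<^sup>2)"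
    by (rule member_le_sum) auto
  then show ?thesis using I_div_ge[OF assms] by linarith
qed

lemma I_div_nonneg:
  fixes x y :: "real ^ 'k::finite"
  assumes "x \<in> nonneg" "\<And>j. 0 < y $ j"
  shows "0 \<le> I_div x y"
  using I_div_ge_component[OF assms] zero_le_power2 by (rule order_trans[rotated])

text \<open>Splits ln (z / y) into ln (z / x) + ln (x / y). The last sum is the derivative of
  \<open>I_div _ y\<close> at \<open>x\<close> in the direction \<open>z - x\<close>, so it vanishes
  when \<open>x\<close> is stationary in that direction.\<close>

lemma I_div_three_point:
  fixes x y z :: "real ^ 'k::finite"
  assumes "z \<in> nonneg" "\<And>j. 0 < x $ j" "\<And>j. 0 < y $ j"
  shows "I_div z y = I_div z x + I_div x y + (\<Sum>j\<in>UNIV. (z $ j - x $ j) * ln (x $ j / y $ j))"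
proof -
  have "z $ j * ln (z $ j / y $ j) - z $ j + y $ j =
      z $ j * ln (z $ j / x $ j) - z $ j + x $ j + (x $ j * ln (x $ j / y $ j) - x $ j + y $ j)
      + (z $ j - x $ j) * ln (x $ j / y $ j)" for j
  proof (cases "z $ j = 0")
    case True
    then show ?thesis by simp
  next
    case False
    then have "0 < z $ j" using assms(1) by (simp add: nonneg_def order_less_le)
    then show ?thesis
      using assms(2,3)[of j] by (simp add: ln_div algebra_simps)
  qed
  then show ?thesis
    unfolding I_div_def sum.distrib[symmetric] by (intro sum.cong refl)
qed

section \<open>Continuity, coercivity and existence of minimisers\<close>

lemma continuous_on_mult_ln: "continuous_on {0..} (\<lambda>t::real. t * ln t)"
proof (rule continuous_on_eq_continuous_within[THEN iffD2], rule ballI)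
  fix t :: real assume "t \<in> {0..}"
  show "continuous (at t within {0..}) (\<lambda>t. t * ln t)"
  proof (cases "t = 0")
    case True
    have "((\<lambda>t::real. t * ln t) \<longlongrightarrow> 0) (at_right 0)" by real_asymp
    moreover have "at (0::real) within {0..} = at_right 0"
      by (rule at_within_nhd[where S=UNIV]) auto
    ultimately show ?thesis using True by (simp add: continuous_within)
  next
    case False
    then show ?thesis by (intro continuous_intros) auto
  qed
qed

lemma I_div_continuous_on:
  fixes y :: "real ^ 'k::finite"
  assumes y: "\<And>j. 0 < y $ j"
  shows "continuous_on nonneg (\<lambda>x. I_div x y)"
proof -
  have "continuous_on nonneg (\<lambda>x. \<Sum>j\<in>UNIV. x $ j * ln (x $ j) - x $ j * ln (y $ j) - x $ j + y $ j)"
    by (intro continuous_intros continuous_on_compose2[OF continuous_on_mult_ln])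
       (auto simp: nonneg_def)
  moreover have "x $ j * ln (x $ j / y $ j) = x $ j * ln (x $ j) - x $ j * ln (y $ j)"
    if "x \<in> nonneg" for x j
  proof (cases "x $ j = 0")
    case False
    then have "0 < x $ j" using that by (simp add: nonneg_def order_less_le)
    then show ?thesis using y[of j] by (simp add: ln_div algebra_simps)
  qed simp
  ultimately show ?thesis
    by (subst continuous_on_cong[OF refl]) (auto simp: I_div_def)
qed

lemma closed_nonneg: "closed (nonneg :: (real ^ 'k::finite) set)"
  unfolding nonneg_def by (intro closed_Collect_all closed_Collect_le continuous_intros)

lemma convex_nonneg: "convex (nonneg :: (real ^ 'k::finite) set)"
  by (auto simp: convex_def nonneg_def)

lemma sqrt_diff_power2_le_imp_le:
  fixes x y :: real
  assumes "(sqrt x - sqrt y)\<^sup>2 \<le> C" "0 \<le> x"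
  shows "x \<le> (sqrt y + sqrt C)\<^sup>2"
proof -
  have "sqrt x - sqrt y \<le> sqrt C" by (rule real_le_rsqrt[OF assms(1)])
  then have "sqrt x \<le> sqrt y + sqrt C" by simp
  then have "(sqrt x)\<^sup>2 \<le> (sqrt y + sqrt C)\<^sup>2" using assms(2) by (intro power_mono) auto
  then show ?thesis using assms(2) by simp
qed

text \<open>The sublevel set of a point \<open>z0\<close> of \<open>C\<close> lies in a box, where
  compactness gives a minimiser; points of \<open>C\<close> outside the box have divergence above
  that of \<open>z0\<close>.\<close>

lemma I_div_attains_min:
  fixes y :: "real ^ 'k::finite"
  assumes y: "\<And>j. 0 < y $ j" and C: "closed C" "C \<subseteq> nonneg" "C \<noteq> {}"
  shows "\<exists>x\<in>C. \<forall>z\<in>C. I_div x y \<le> I_div z y"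
proof -
  obtain z0 where z0: "z0 \<in> C" using C by blast
  \<comment> \<open>A coordinatewise bound on the sublevel set, read off from the Hellinger
    estimate.\<close>
  define r where "r j = (sqrt (y $ j) + sqrt (I_div z0 y))\<^sup>2" for j
  have le: "x $ j \<le> r j" if "x \<in> C" "I_div x y \<le> I_div z0 y" for x j
  proof -
    have x: "x \<in> nonneg" using that C by blast
    have "(sqrt (x $ j) - sqrt (y $ j))\<^sup>2 \<le> I_div z0 y"
      using I_div_ge_component[where y = y and j = j, OF x y] that by linarith
    then show ?thesis
      unfolding r_def using x by (intro sqrt_diff_power2_le_imp_le) (auto simp: nonneg_def)
  qed
  define K where "K = C \<inter> {0 .. \<chi> j. r j}"
  have mem: "x \<in> K" if "x \<in> C" "I_div x y \<le> I_div z0 y" for x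
    using le[OF that] that C(2) by (auto simp: K_def less_eq_vec_def nonneg_def)
  have "compact K"
    unfolding K_def by (intro closed_Int_compact C) (simp flip: interval_cbox)
  moreover have "K \<noteq> {}" using mem z0 by blast
  moreover have "continuous_on K (\<lambda>x. I_div x y)"
    using C(2) by (intro continuous_on_subset[OF I_div_continuous_on] y) (auto simp: K_def)
  ultimately obtain x where x: "x \<in> K" "\<And>z. z \<in> K \<Longrightarrow> I_div x y \<le> I_div z y"
    using continuous_attains_inf[of K "\<lambda>x. I_div x y"] by blast
  show ?thesis
  proof (intro bexI[of _ x] ballI)
    show "x \<in> C" using x by (simp add: K_def)
    fix z assume z: "z \<in> C"
    show "I_div x y \<le> I_div z y"
    proof (cases "I_div z y \<le> I_div z0 y")
      case True
      then show ?thesis using x mem z by blast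
    next
      case False
      then show ?thesis using x(2)[of z0] mem z0 by force
    qed
  qed
qed

section \<open>Uniqueness and positivity of I-projections\<close>

text \<open>Strict convexity by coordinates, boundary included: in the expansion around the midpoint
  \<open>m\<close> the linear terms cancel, and the remainders dominate squared differences of
  square roots.\<close>

lemma I_div_midpoint:
  fixes y :: "real ^ 'k::finite"
  assumes y: "\<And>j. 0 < y $ j" and uv: "u \<in> nonneg" "v \<in> nonneg" "u \<noteq> v"
  shows "2 * I_div ((1/2) *\<^sub>R u + (1/2) *\<^sub>R v) y < I_div u y + I_div v y"
proof -
  define f where "f j t = t * ln (t / y $ j) - t + y $ j" for j t
  have f: "2 * f j ((s + t) / 2) \<le> f j s + f j t \<and> (s \<noteq> t \<longrightarrow> 2 * f j ((s + t) / 2) < f j s + f j t)"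
    if st: "0 \<le> s" "0 \<le> t" for j s t
  \<comment> \<open>Only here does the midpoint fail to be positive, and then both arguments
    vanish.\<close>
  proof (cases "s + t = 0")
    case True
    then have "s = 0" "t = 0" using st by linarith+
    then show ?thesis by simp
  next
    case False
    define m where "m = (s + t) / 2"
    have m: "0 < m" using False st by (simp add: m_def)
    have split: "f j r = r * ln (r / m) - r + m + f j m + (r - m) * ln (m / y $ j)" if "0 \<le> r" for r
    proof (cases "r = 0")
      case False
      then have "0 < r" using that by simp
      then show ?thesis using m y[of j] unfolding f_def by (simp add: ln_div algebra_simps)
    qed (simp add: f_def algebra_simps)
    have lin: "(s - m) * ln (m / y $ j) + (t - m) * ln (m / y $ j) = 0"
      by (simp flip: distrib_right) (simp add: m_def)
    have ge: "(sqrt s - sqrt m)\<^sup>2 + (sqrt t - sqrt m)\<^sup>2 \<le> f j s + f j t - 2 * f j m"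
      using split[OF st(1)] split[OF st(2)] lin I_div_term_ge[OF st(1) m] I_div_term_ge[OF st(2) m]
      by linarith
    moreover have "0 < (sqrt s - sqrt m)\<^sup>2" if "s \<noteq> t"
    proof -
      have "s \<noteq> m" using that by (simp add: m_def field_simps)
      then show ?thesis by simp
    qed
    ultimately show ?thesis
      using zero_le_power2[of "sqrt s - sqrt m"] zero_le_power2[of "sqrt t - sqrt m"]
      unfolding m_def by linarith
  qed
  obtain i where i: "u $ i \<noteq> v $ i" using uv by (auto simp: vec_eq_iff)
  have "(\<Sum>j\<in>UNIV. 2 * f j ((u $ j + v $ j) / 2)) < (\<Sum>j\<in>UNIV. f j (u $ j) + f j (v $ j))"
  proof (rule sum_strict_mono_ex1)
    show "\<exists>j\<in>UNIV. 2 * f j ((u $ j + v $ j) / 2) < f j (u $ j) + f j (v $ j)"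
      using f[of "u $ i" "v $ i" i] uv i by (intro bexI[of _ i]) (auto simp: nonneg_def)
  qed (use f uv in \<open>auto simp: nonneg_def\<close>)
  moreover have "I_div w y = (\<Sum>j\<in>UNIV. f j (w $ j))" for w
    by (simp add: I_div_def f_def)
  ultimately show ?thesis by (simp add: sum.distrib sum_distrib_left add_divide_distrib)
qed

text \<open>Two distinct minimisers would have a midpoint in \<open>C\<close> of strictly smaller
  divergence.\<close>

lemma I_projection_exists:
  fixes y :: "real ^ 'k::finite"
  assumes y: "\<And>j. 0 < y $ j" and C: "closed C" "convex C" "C \<subseteq> nonneg" "C \<noteq> {}"
  shows "\<exists>x. bregman_projection I_div C y x"
proof -
  obtain x where x: "x \<in> C" "\<And>z. z \<in> C \<Longrightarrow> I_div x y \<le> I_div z y"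
    using I_div_attains_min[OF y C(1,3,4)] by blast
  have "unique_arg_min (\<lambda>z. I_div z y) C x"
  proof (rule unique_arg_minI)
    fix z assume z: "z \<in> C" "I_div z y \<le> I_div x y"
    show "z = x"
    proof (rule ccontr)
      assume "z \<noteq> x"
      then have "2 * I_div ((1/2) *\<^sub>R z + (1/2) *\<^sub>R x) y < I_div z y + I_div x y"
        using z x C by (intro I_div_midpoint y) auto
      moreover have "(1/2) *\<^sub>R z + (1/2) *\<^sub>R x \<in> C"
        using C(2) z x by (intro convexD) auto
      ultimately show False using x(2) z(2) by force
    qed
  qed (use x in auto)
  then show ?thesis unfolding bregman_projection_def by blast
qed

text \<open>
  With \<open>u = x + t (p - x)\<close> for \<open>0 < t \<le> 1\<close>, the three-point identity and the minimality of \<open>x\<close>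
  give \<open>0 \<le> \<Sum>j. (p j - x j) ln (u j / y j)\<close>.  Each summand is at most its value at \<open>t = 1\<close>,
  but the one with \<open>x j = 0\<close> tends to \<open>-\<infinity>\<close> as \<open>t \<rightarrow> 0\<close>.
\<close>

lemma I_projection_positive:
  fixes y :: "real ^ 'k::finite"
  assumes y: "\<And>j. 0 < y $ j" and C: "convex C" "C \<subseteq> nonneg"
    and p: "p \<in> C" "\<And>j. 0 < p $ j" and x: "bregman_projection I_div C y x"
  shows "0 < x $ i"
proof (rule ccontr)
  assume "\<not> 0 < x $ i"
  have xC: "x \<in> C" and min: "\<And>z. z \<in> C \<Longrightarrow> I_div x y \<le> I_div z y"
    using x unfolding bregman_projection_def
    by (auto intro: unique_arg_min_mem unique_arg_min_le)
  have x0: "0 \<le> x $ j" for j using xC C(2) by (auto simp: nonneg_def)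
  have xi: "x $ i = 0" using \<open>\<not> 0 < x $ i\<close> x0[of i] by linarith
  define c where "c j = (p $ j - x $ j) * ln (p $ j / y $ j)" for j
  have key: "0 \<le> p $ i * ln t + (\<Sum>j\<in>UNIV. c j)" if t: "0 < t" "t \<le> 1" for t
  proof -
    define u where "u = (1 - t) *\<^sub>R x + t *\<^sub>R p"
    have uC: "u \<in> C" unfolding u_def using C(1) xC p(1) t by (intro convexD) auto
    have u: "u $ j = x $ j + t * (p $ j - x $ j)" for j by (simp add: u_def algebra_simps)
    have u0: "0 < u $ j" for j
      unfolding u_def using t x0[of j] p(2)[of j] by (simp add: add_nonneg_pos)
    have "I_div x y = I_div x u + I_div u y + (\<Sum>j\<in>UNIV. (x $ j - u $ j) * ln (u $ j / y $ j))"
      using xC C(2) u0 y by (intro I_div_three_point) auto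
    moreover have "0 \<le> I_div x u" using xC C(2) u0 by (intro I_div_nonneg) auto
    moreover have "(\<Sum>j\<in>UNIV. (x $ j - u $ j) * ln (u $ j / y $ j))
        = - t * (\<Sum>j\<in>UNIV. (p $ j - x $ j) * ln (u $ j / y $ j))"
      unfolding sum_distrib_left by (rule sum.cong) (simp_all add: u algebra_simps)
    ultimately have "0 \<le> t * (\<Sum>j\<in>UNIV. (p $ j - x $ j) * ln (u $ j / y $ j))"
      using min[OF uC] by simp
    then have "0 \<le> (\<Sum>j\<in>UNIV. (p $ j - x $ j) * ln (u $ j / y $ j))"
      using t by (simp add: zero_le_mult_iff)
    also have "\<dots> \<le> (\<Sum>j\<in>UNIV. c j + (if j = i then p $ i * ln t else 0))"
    proof (rule sum_mono)
      fix j
      show "(p $ j - x $ j) * ln (u $ j / y $ j) \<le> c j + (if j = i then p $ i * ln t else 0)"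
      proof (cases "j = i")
        case True
        then show ?thesis
          using xi t p(2)[of i] y[of i] by (simp add: c_def u ln_div ln_mult algebra_simps)
      next
        case False
        \<comment> \<open>As \<open>t\<close> is at most 1, the sign of \<open>p $ j - x $ j\<close>
          decides on which side of \<open>p $ j\<close> the value \<open>u $ j\<close> lies; either
          way, replacing \<open>u $ j\<close> by \<open>p $ j\<close> does not decrease the
          product.\<close>
        have "(p $ j - x $ j) * ln (u $ j / y $ j) \<le> (p $ j - x $ j) * ln (p $ j / y $ j)"
        proof (cases "x $ j \<le> p $ j")
          case True
          have "t * (p $ j - x $ j) \<le> 1 * (p $ j - x $ j)"
            using t True by (intro mult_right_mono) auto
          then have "u $ j \<le> p $ j" by (simp add: u)
          then show ?thesis using True u0[of j] y[of j]
            by (intro mult_left_mono) (auto simp: divide_right_mono p)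
        next
          case False
          have "1 * (p $ j - x $ j) \<le> t * (p $ j - x $ j)"
            using t False by (intro mult_right_mono_neg) auto
          then have "p $ j \<le> u $ j" by (simp add: u)
          then show ?thesis using False u0[of j] y[of j] p(2)[of j]
            by (intro mult_left_mono_neg) (auto simp: divide_right_mono)
        qed
        then show ?thesis using False by (simp add: c_def)
      qed
    qed
    finally show ?thesis by (simp add: sum.distrib)
  qed
  \<comment> \<open>The witness is t = exp (- S / p i): it is at most 1 as \<open>S\<close> is
    positive, and it turns the right side of \<open>key\<close> into the sum minus \<open>S\<close>,
    which is at most -1.\<close>
  define S where "S = \<bar>\<Sum>j\<in>UNIV. c j\<bar> + 1"
  have "0 \<le> p $ i * ln (exp (- (S / p $ i))) + (\<Sum>j\<in>UNIV. c j)"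
    by (rule key) (use p(2)[of i] in \<open>auto simp: S_def\<close>)
  then show False using p(2)[of i] by (simp add: S_def)
qed

section \<open>First-order condition and Pythagorean identity\<close>

text \<open>Positivity of \<open>x\<close> keeps small steps in both directions along the line
  through \<open>x\<close> and \<open>z\<close> inside the orthant, so \<open>g\<close>, the
  divergence along that line, has a two-sided local minimum at 0. As \<open>z\<close> ranges over
  all of \<open>B\<close>, every direction of \<open>B\<close> is tested.\<close>

lemma I_projection_stationary:
  fixes y :: "real ^ 'k::finite"
  assumes y: "\<And>j. 0 < y $ j" and B: "affine B" "z \<in> B"
    and x: "bregman_projection I_div (B \<inter> nonneg) y x" "\<And>j. 0 < x $ j"
  shows "(\<Sum>j\<in>UNIV. (z $ j - x $ j) * ln (x $ j / y $ j)) = 0"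
proof -
  define h where "h j = z $ j - x $ j" for j
  define g where "g t = (\<Sum>j\<in>UNIV. (x $ j + t * h j) * ln ((x $ j + t * h j) / y $ j)
      - (x $ j + t * h j) + y $ j)" for t :: real
  have x': "x \<in> B" and min: "\<And>w. w \<in> B \<inter> nonneg \<Longrightarrow> I_div x y \<le> I_div w y"
    using x(1) unfolding bregman_projection_def
    by (auto dest: unique_arg_min_mem unique_arg_min_le)
  have deriv: "(g has_real_derivative (\<Sum>j\<in>UNIV. h j * ln (x $ j / y $ j))) (at 0)"
    unfolding g_def
  proof (rule DERIV_sum)
    fix j
    show "((\<lambda>t. (x $ j + t * h j) * ln ((x $ j + t * h j) / y $ j) - (x $ j + t * h j) + y $ j)
        has_real_derivative h j * ln (x $ j / y $ j)) (at 0)"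
      using x(2)[of j] y[of j]
      by (auto intro!: derivative_eq_intros simp: field_simps)
  qed
  have "\<forall>\<^sub>F t in at 0. \<forall>j. 0 < x $ j + t * h j"
  proof (rule eventually_all_finite)
    fix j
    have "((\<lambda>t. x $ j + t * h j) \<longlongrightarrow> x $ j + 0 * h j) (at 0)" by (intro tendsto_intros)
    then show "\<forall>\<^sub>F t in at 0. 0 < x $ j + t * h j"
      using x(2)[of j] by (intro order_tendstoD(1)) auto
  qed
  then obtain e where e: "0 < e" "\<And>t j. t \<noteq> 0 \<Longrightarrow> dist t 0 < e \<Longrightarrow> 0 < x $ j + t * h j"
    unfolding eventually_at by blast
  have "g 0 \<le> g t" if "\<bar>0 - t\<bar> < e" for t
  proof (cases "t = 0")
    case False
    define w where "w = (1 - t) *\<^sub>R x + t *\<^sub>R z"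
    have w: "w $ j = x $ j + t * h j" for j by (simp add: w_def h_def algebra_simps)
    have "w \<in> B" unfolding w_def using B x' by (intro mem_affine) auto
    moreover have "w \<in> nonneg"
      using e(2)[OF False] that by (auto simp: nonneg_def w less_imp_le)
    ultimately have "I_div x y \<le> I_div w y" using min by blast
    then show ?thesis by (simp add: I_div_def g_def w)
  qed simp
  then show ?thesis
    using DERIV_local_min[OF deriv e(1)] by (simp add: h_def)
qed

text \<open>Stationarity removes the last sum of the three-point identity.\<close>

lemma I_projection_pythagoras:
  fixes y :: "real ^ 'k::finite"
  assumes y: "\<And>j. 0 < y $ j" and B: "affine B" "z \<in> B" "z \<in> nonneg"
    and x: "bregman_projection I_div (B \<inter> nonneg) y x" "\<And>j. 0 < x $ j"
  shows "I_div z y = I_div z x + I_div x y"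
  using I_div_three_point[where z=z and x=x and y=y, OF B(3) x(2) y]
    I_projection_stationary[where y=y, OF y B(1,2) x] by simp

text \<open>The gradient of \<open>neg_entropy\<close> at a positive \<open>y\<close> has the
  components \<open>ln (y $ j)\<close>.\<close>

lemma bregman_divergence_neg_entropy:
  fixes x y :: "real ^ 'k::finite"
  assumes "x \<in> nonneg" and y: "\<And>j. 0 < y $ j"
  shows "bregman_divergence neg_entropy x y = I_div x y"
proof -
  have "(neg_entropy has_derivative (\<lambda>h. \<Sum>j\<in>UNIV. h $ j * ln (y $ j))) (at y)"
    unfolding neg_entropy_def
  proof (rule has_derivative_sum)
    fix j
    have "((\<lambda>t. t * ln t - t) has_real_derivative ln (y $ j)) (at (y $ j))"
      using y[of j] by (auto intro!: derivative_eq_intros)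
    then have "((\<lambda>t. t * ln t - t) has_derivative (\<lambda>h. h * ln (y $ j))) (at (y $ j))"
      by (simp add: has_field_derivative_def mult_commute_abs)
    from has_derivative_compose[OF bounded_linear_imp_has_derivative[OF bounded_linear_vec_nth] this]
    show "((\<lambda>x. x $ j * ln (x $ j) - x $ j) has_derivative (\<lambda>h. h $ j * ln (y $ j))) (at y)" .
  qed
  then have "bregman_divergence neg_entropy x y
      = (\<Sum>j\<in>UNIV. x $ j * ln (x $ j) - x $ j - (y $ j * ln (y $ j) - y $ j)
          - (x $ j - y $ j) * ln (y $ j))"
    unfolding bregman_divergence_def
    by (simp add: frechet_derivative_at[symmetric] neg_entropy_def sum_subtractf)
  also have "\<dots> = I_div x y"
    unfolding I_div_def
  proof (rule sum.cong)
    fix j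
    show "x $ j * ln (x $ j) - x $ j - (y $ j * ln (y $ j) - y $ j) - (x $ j - y $ j) * ln (y $ j)
        = x $ j * ln (x $ j / y $ j) - x $ j + y $ j"
    proof (cases "x $ j = 0")
      case False
      then have "0 < x $ j" using assms(1) by (simp add: nonneg_def order_less_le)
      then show ?thesis using y[of j] by (simp add: ln_div algebra_simps)
    qed simp
  qed simp
  finally show ?thesis .
qed

section \<open>Cyclic I-projections onto affine sets\<close>

text \<open>The Hellinger bound squeezes the squares. Limits are therefore tracked on square roots
  and carried back by \<open>tendsto_of_sqrt\<close>.\<close>

lemma I_div_tendsto_0_sqrt:
  fixes U V :: "nat \<Rightarrow> real ^ 'k::finite"
  assumes "(\<lambda>k. I_div (U k) (V k)) \<longlonglongrightarrow> 0" "\<And>k. U k \<in> nonneg" "\<And>k j. 0 < V k $ j"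
  shows "(\<lambda>k. sqrt (U k $ j) - sqrt (V k $ j)) \<longlonglongrightarrow> 0"
proof -
  have "(\<lambda>k. (sqrt (U k $ j) - sqrt (V k $ j))\<^sup>2) \<longlonglongrightarrow> 0"
    by (rule tendsto_sandwich[OF _ _ tendsto_const assms(1)])
       (auto intro!: always_eventually I_div_ge_component assms)
  from tendsto_real_sqrt[OF this] show ?thesis
    by (auto intro: tendsto_rabs_zero_cancel)
qed

lemma tendsto_of_sqrt:
  fixes f :: "nat \<Rightarrow> real"
  assumes "(\<lambda>k. sqrt (f k)) \<longlonglongrightarrow> sqrt a" "\<And>k. 0 \<le> f k" "0 \<le> a"
  shows "f \<longlonglongrightarrow> a"
  using tendsto_power[OF assms(1), of 2] assms(2,3) by simp

text \<open>The upper bound is the Hellinger estimate. For the lower one, a single summand is at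
  most \<open>C\<close>; dropping its term \<open>v $ j\<close> and solving for the logarithm bounds
  \<open>v $ j\<close> away from 0, which keeps limit points off the boundary.\<close>

lemma I_div_right_bounded:
  fixes p v :: "real ^ 'k::finite"
  assumes p: "\<And>j. 0 < p $ j" and v: "\<And>j. 0 < v $ j" and le: "I_div p v \<le> C"
  shows "p $ j * exp (- (C + p $ j) / p $ j) \<le> v $ j" "v $ j \<le> (sqrt (p $ j) + sqrt C)\<^sup>2"
proof -
  have pn: "p \<in> nonneg" using p by (simp add: nonneg_def less_imp_le)
  show "v $ j \<le> (sqrt (p $ j) + sqrt C)\<^sup>2"
    using I_div_ge_component[of p v j, OF pn v] le v[of j]
    by (intro sqrt_diff_power2_le_imp_le) (auto simp: power2_commute)
  have "p $ j * ln (p $ j / v $ j) - p $ j + v $ j \<le> I_div p v"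
    unfolding I_div_def
  proof (rule member_le_sum)
    fix i
    show "0 \<le> p $ i * ln (p $ i / v $ i) - p $ i + v $ i"
      using I_div_term_ge[of "p $ i" "v $ i"] p[of i] v[of i] zero_le_power2
      by (smt (verit))
  qed auto
  then have "p $ j * (ln (p $ j) - ln (v $ j)) \<le> C + p $ j"
    using le v[of j] p[of j] by (simp add: ln_div)
  then have "ln (p $ j) - ln (v $ j) \<le> (C + p $ j) / p $ j"
    using p[of j] by (simp add: pos_le_divide_eq mult.commute)
  then have "ln (p $ j) + - (C + p $ j) / p $ j \<le> ln (v $ j)"
    unfolding minus_divide_left[symmetric] by linarith
  then have "exp (ln (p $ j) + - (C + p $ j) / p $ j) \<le> exp (ln (v $ j))"
    by (simp only: exp_le_cancel_iff)
  then show "p $ j * exp (- (C + p $ j) / p $ j) \<le> v $ j"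
    using p[of j] v[of j] by (simp only: exp_add exp_ln)
qed

text \<open>
  For \<open>z\<close> in all the sets, Pythagoras makes \<open>I_div z (X k)\<close> decrease by \<open>I_div (X (Suc k)) (X k)\<close>.
  With \<open>z = p\<close> this keeps \<open>X\<close> in a compact part of the open orthant and makes successive iterates
  merge, so a cluster point \<open>a\<close> lies in all the sets; with \<open>z = a\<close> it gives convergence to \<open>a\<close>.
  The stationarity of each projection survives summation and passage to the limit, so \<open>a\<close> is
  stationary over the intersection.
\<close>

theorem cyclic_I_projections_converge:
  fixes y :: "real ^ 'k::finite" and Bs :: "(real ^ 'k) set list"
  assumes y: "\<And>j. 0 < y $ j" and ne: "Bs \<noteq> []" and aff: "\<And>B. B \<in> set Bs \<Longrightarrow> affine B"
    and p: "p \<in> \<Inter> (set Bs)" "\<And>j. 0 < p $ j"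
    and x: "bregman_projection I_div (\<Inter> (set Bs) \<inter> nonneg) y x"
  shows "\<exists>X. cyclic_projections I_div (map (\<lambda>B. B \<inter> nonneg) Bs) y X \<and>
    (\<forall>k j. 0 < X k $ j) \<and> X \<longlonglongrightarrow> x"
proof -
  define L where "L = length Bs"
  have L: "0 < L" using ne by (simp add: L_def)
  define B where "B k = Bs ! (k mod L)" for k
  have Bs: "B k \<in> set Bs" for k using L by (simp add: B_def L_def)
  have affB: "affine (B k)" for k using aff Bs by blast
  have pn: "p \<in> nonneg" using p(2) by (simp add: nonneg_def less_imp_le)
  \<comment> \<open>All the sets share the positive point \<open>p\<close>, so positivity passes
    from each iterate to the next.\<close>
  have step: "\<exists>w. (\<forall>j. 0 < w $ j) \<and> bregman_projection I_div (B k \<inter> nonneg) v w"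
    if v: "\<And>j. 0 < v $ j" for v k
  proof -
    have pB: "p \<in> B k \<inter> nonneg" using p(1) pn Bs by blast
    have conv: "convex (B k \<inter> nonneg)"
      by (intro convex_Int convex_nonneg affine_imp_convex affB)
    have "closed (B k \<inter> nonneg)" by (intro closed_Int affine_closed affB closed_nonneg)
    then obtain w where w: "bregman_projection I_div (B k \<inter> nonneg) v w"
      using I_projection_exists[where y=v, OF v _ conv] pB by blast
    then have "\<forall>j. 0 < w $ j"
      using I_projection_positive[where y=v, OF v conv _ pB p(2)] by auto
    then show ?thesis using w by blast
  qed
  \<comment> \<open>The clause for \<open>k = 0\<close> carries the starting point through dependent
    choice.\<close>
  have "\<exists>X. \<forall>k. ((\<forall>j. 0 < X k $ j) \<and> (k = 0 \<longrightarrow> X k = y)) \<and>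
      bregman_projection I_div (B k \<inter> nonneg) (X k) (X (Suc k))"
    using y step by (intro dependent_nat_choice) auto
  then obtain X where X: "\<And>k. (\<forall>j. 0 < X k $ j) \<and> (k = 0 \<longrightarrow> X k = y)"
    "\<And>k. bregman_projection I_div (B k \<inter> nonneg) (X k) (X (Suc k))"
    by blast
  have X0: "X 0 = y" and Xpos: "\<And>k j. 0 < X k $ j" using X(1) by auto
  have Xn: "X k \<in> nonneg" for k using Xpos by (simp add: nonneg_def less_imp_le)
  have XB: "X (Suc k) \<in> B k" for k
    using X(2)[of k] unfolding bregman_projection_def by (auto dest: unique_arg_min_mem)
  have cyc: "cyclic_projections I_div (map (\<lambda>B. B \<inter> nonneg) Bs) y X"
    using X(2) X0 L unfolding cyclic_projections_def B_def by (simp add: L_def)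
  have pyth: "I_div z (X k) = I_div z (X (Suc k)) + I_div (X (Suc k)) (X k)"
    if "z \<in> \<Inter> (set Bs)" "z \<in> nonneg" for z k
    using that Bs by (intro I_projection_pythagoras[OF Xpos affB _ _ X(2) Xpos]) auto
  have decr: "decseq (\<lambda>k. I_div z (X k))" if "z \<in> \<Inter> (set Bs)" "z \<in> nonneg" for z
  proof (rule decseq_SucI)
    fix k show "I_div z (X (Suc k)) \<le> I_div z (X k)"
      using pyth[OF that, of k] I_div_nonneg[where x="X (Suc k)" and y="X k", OF Xn Xpos] by linarith
  qed
  have conv: "convergent (\<lambda>k. I_div z (X k))" if z: "z \<in> \<Inter> (set Bs)" "z \<in> nonneg" for z
  proof -
    obtain l where "(\<lambda>k. I_div z (X k)) \<longlonglongrightarrow> l"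
      using decseq_convergent[OF decr[OF z], of 0] I_div_nonneg[OF z(2) Xpos] by blast
    then show ?thesis by (rule convergentI)
  qed
  \<comment> \<open>These are the successive drops of the convergent sequence
    \<open>I_div p (X k)\<close>.\<close>
  have "(\<lambda>k. I_div (X (Suc k)) (X k)) \<longlonglongrightarrow> 0"
  proof -
    obtain l where l: "(\<lambda>k. I_div p (X k)) \<longlonglongrightarrow> l" using conv[OF p(1) pn] convergent_def by blast
    have "(\<lambda>k. I_div p (X k) - I_div p (X (Suc k))) \<longlonglongrightarrow> l - l"
      by (intro tendsto_diff l LIMSEQ_Suc)
    moreover have "I_div p (X k) - I_div p (X (Suc k)) = I_div (X (Suc k)) (X k)" for k
      using pyth[OF p(1) pn, of k] by linarith
    ultimately show ?thesis by simp
  qed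
  then have merge: "(\<lambda>k. sqrt (X (Suc k) $ j) - sqrt (X k $ j)) \<longlonglongrightarrow> 0" for j
    by (rule I_div_tendsto_0_sqrt) (rule Xn Xpos)+
  define C where "C = I_div p y"
  define lo where "lo = (\<chi> j. p $ j * exp (- (C + p $ j) / p $ j))"
  define hi where "hi = (\<chi> j. (sqrt (p $ j) + sqrt C)\<^sup>2)"
  have "X k \<in> {lo..hi}" for k
  proof -
    have "I_div p (X k) \<le> C"
      using decseqD[OF decr[OF p(1) pn], of 0 k] by (simp add: C_def X0)
    then show ?thesis
      using I_div_right_bounded[where p=p and v="X k", OF p(2) Xpos]
      by (simp add: less_eq_vec_def lo_def hi_def)
  qed
  moreover have "compact {lo..hi}" by (simp flip: interval_cbox)
  \<comment> \<open>Sampling at multiples of \<open>L\<close> fixes the phase of the cycle: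
    \<open>X (r k * L + Suc i)\<close> always lies in \<open>Bs ! i\<close>.\<close>
  ultimately obtain a r where a: "a \<in> {lo..hi}" "strict_mono r"
      "((\<lambda>k. X (k * L)) \<circ> r) \<longlonglongrightarrow> a"
    unfolding compact_def by (elim allE[of _ "\<lambda>k. X (k * L)"]) blast
  have apos: "0 < a $ j" for j
  proof -
    have "0 < lo $ j" using p(2) by (simp add: lo_def)
    also have "\<dots> \<le> a $ j" using a(1) by (simp add: less_eq_vec_def)
    finally show ?thesis .
  qed
  have an: "a \<in> nonneg" using apos by (simp add: nonneg_def less_imp_le)
  have sub: "strict_mono (\<lambda>k. r k * L + s)" for s
    using a(2) L by (simp add: strict_mono_def)
  \<comment> \<open>Consecutive iterates merge, so the limit at phase 0 passes to every later
    phase.\<close>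
  have shift: "(\<lambda>k. sqrt (X (r k * L + s) $ j)) \<longlonglongrightarrow> sqrt (a $ j)" for s j
  proof (induction s)
    case 0
    show ?case using a(3) by (auto simp: o_def intro!: tendsto_intros)
  next
    case (Suc s)
    have "(\<lambda>k. sqrt (X (Suc (r k * L + s)) $ j) - sqrt (X (r k * L + s) $ j)) \<longlonglongrightarrow> 0"
      using LIMSEQ_subseq_LIMSEQ[OF merge sub] by (simp add: o_def)
    from tendsto_add[OF this Suc] show ?case by simp
  qed
  have shift': "(\<lambda>k. X (r k * L + s)) \<longlonglongrightarrow> a" for s
    using Xpos apos
    by (intro vec_tendstoI tendsto_of_sqrt[OF shift]) (auto intro: less_imp_le)
  have aB: "a \<in> \<Inter> (set Bs)"
  proof
    fix S assume "S \<in> set Bs"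
    then obtain i where i: "i < L" "S = Bs ! i" by (auto simp: in_set_conv_nth L_def)
    have "closed S" using \<open>S \<in> set Bs\<close> aff affine_closed by blast
    moreover have "X (r k * L + Suc i) \<in> S" for k
      using XB[of "r k * L + i"] i by (simp add: B_def)
    ultimately show "a \<in> S" by (rule closed_sequentially) (rule shift')
  qed
  \<comment> \<open>The whole sequence of divergences converges, and its limit is 0 because it is so
    along the subsequence.\<close>
  have "(\<lambda>k. I_div a (X k)) \<longlonglongrightarrow> 0"
  proof -
    obtain l where l: "(\<lambda>k. I_div a (X k)) \<longlonglongrightarrow> l" using conv[OF aB an] convergent_def by blast
    have "(\<lambda>k. I_div a (X (r k * L))) \<longlonglongrightarrow> I_div a a"
      unfolding I_div_def using apos a(3)
      by (intro tendsto_intros) (auto simp: o_def less_imp_neq[symmetric])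
    moreover have "I_div a a = 0" using apos by (simp add: I_div_def less_imp_neq[symmetric])
    moreover have "(\<lambda>k. I_div a (X (r k * L))) \<longlonglongrightarrow> l"
      using LIMSEQ_subseq_LIMSEQ[OF l sub[of 0]] by (simp add: o_def)
    ultimately have "l = 0" using LIMSEQ_unique by fastforce
    then show ?thesis using l by simp
  qed
  then have "(\<lambda>k. sqrt (a $ j) - sqrt (X k $ j)) \<longlonglongrightarrow> 0" for j
    by (rule I_div_tendsto_0_sqrt) (rule an Xpos)+
  from tendsto_diff[OF tendsto_const this]
  have sqrt_lim: "(\<lambda>k. sqrt (a $ j) - (sqrt (a $ j) - sqrt (X k $ j))) \<longlonglongrightarrow> sqrt (a $ j) - 0" for j .
  have lim: "X \<longlonglongrightarrow> a"
    using Xpos apos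
    by (intro vec_tendstoI tendsto_of_sqrt[OF sqrt_lim[simplified]]) (auto intro: less_imp_le)
  \<comment> \<open>ln (X k / y) telescopes into logarithms of ratios of consecutive iterates, each
    orthogonal to \<open>z - a\<close>.\<close>
  have stat: "(\<Sum>j\<in>UNIV. (z $ j - a $ j) * ln (X k $ j / y $ j)) = 0" if z: "z \<in> \<Inter> (set Bs)" for z k
  proof (induction k)
    case 0
    show ?case using y by (simp add: X0 less_imp_neq[symmetric])
  next
    case (Suc k)
    have "(\<Sum>j\<in>UNIV. (w $ j - X (Suc k) $ j) * ln (X (Suc k) $ j / X k $ j)) = 0"
      if "w \<in> \<Inter> (set Bs)" for w
      using that Bs by (intro I_projection_stationary[OF Xpos affB _ X(2) Xpos]) auto
    \<comment> \<open>Subtracting the two conditions replaces the moving base point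
      \<open>X (Suc k)\<close> by the fixed \<open>a\<close>.\<close>
    from this[OF z] this[OF aB]
    have "(\<Sum>j\<in>UNIV. (z $ j - a $ j) * ln (X (Suc k) $ j / X k $ j)) = 0"
      by (simp add: left_diff_distrib sum_subtractf)
    then have "(\<Sum>j\<in>UNIV. (z $ j - a $ j) * (ln (X (Suc k) $ j / X k $ j) + ln (X k $ j / y $ j))) = 0"
      using Suc by (simp add: distrib_left sum.distrib)
    moreover have "ln (X (Suc k) $ j / X k $ j) + ln (X k $ j / y $ j) = ln (X (Suc k) $ j / y $ j)" for j
      using Xpos[of "Suc k" j] Xpos[of k j] y[of j] by (simp add: ln_div)
    ultimately show ?case by simp
  qed
  have xB: "x \<in> \<Inter> (set Bs)" "x \<in> nonneg"
    using x unfolding bregman_projection_def by (auto dest: unique_arg_min_mem)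
  have "(\<lambda>k. \<Sum>j\<in>UNIV. (x $ j - a $ j) * ln (X k $ j / y $ j))
      \<longlonglongrightarrow> (\<Sum>j\<in>UNIV. (x $ j - a $ j) * ln (a $ j / y $ j))"
    using apos y by (intro tendsto_intros lim) (auto simp: less_imp_neq[symmetric])
  then have "(\<Sum>j\<in>UNIV. (x $ j - a $ j) * ln (a $ j / y $ j)) = 0"
    unfolding stat[OF xB(1)] by (simp add: LIMSEQ_const_iff)
  \<comment> \<open>The last sum of the three-point identity at \<open>a\<close> is 0, so
    \<open>a\<close> does at least as well as the unique minimiser \<open>x\<close>.\<close>
  then have "I_div a y \<le> I_div x y"
    using I_div_three_point[where z=x and x=a and y=y, OF xB(2) apos y]
      I_div_nonneg[where x=x and y=a, OF xB(2) apos] by simp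
  then have "a = x"
    using x aB an unfolding bregman_projection_def by (auto dest: unique_arg_min_eq)
  then show ?thesis using cyc Xpos lim by blast
qed

section \<open>The cluster system\<close>

lemma A_mat_mult: "A_mat d *v x = (\<chi> e. lhs d x e)"
  unfolding A_mat_def matrix_works[OF linear_lhs[folded linear_matrix_vector_mul_eq]] ..

lemma Rep_move_Abs_move:
  "j \<noteq> Some i \<Longrightarrow> Rep_move (Abs_move (i, j)) = (i, j)"
  by (rule Abs_move_inverse) simp

text \<open>
  Departures, whose columns occur in a single balance equation each, solve the balance equations;
  the retentions, each occurring in a single normalisation equation, then solve the latter.
\<close>

lemma surj_A_mat:
  fixes d :: "'n::finite cluster_data"
  assumes "valid_data d"
  shows "surj ((*v) (A_mat d))"
proof (rule surjI)
  define f where "f w i = - (w $ Bal_active i) / N1 d i" for w :: "real ^ 'n equation" and i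
  define g where "g w i = (case i of None \<Rightarrow> - (w $ Bal_reserve) / Neff d
      | Some k \<Rightarrow> - (w $ Bal_passive k) / N2 d (Some k))" for w :: "real ^ 'n equation" and i
  define x where "x w = (\<chi> c. case c of
      P11_move m \<Rightarrow> (if snd (Rep_move m) = None then f w (fst (Rep_move m)) else 0)
    | P12 i \<Rightarrow> 0
    | P21 i j \<Rightarrow> (if j = None then g w i else 0)
    | Pret_passive i \<Rightarrow> w $ Norm_passive i - g w i
    | Pret_active i \<Rightarrow> w $ Norm_active i - f w i)" for w
  fix w :: "real ^ 'n equation"
  have N: "N1 d i \<noteq> 0" "N2 d j \<noteq> 0" "Neff d \<noteq> 0" for i j
    using assms by (auto simp: valid_data_def Neff_def less_imp_neq[symmetric]
        intro!: less_imp_neq[symmetric] add_nonneg_pos)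
  have x11: "x w $ P11 i j = (if j = None then f w i else 0)" if "j \<noteq> Some i" for i j
    using that by (simp add: x_def Rep_move_Abs_move)
  have x12: "x w $ P12 i = 0" for i by (simp add: x_def)
  have x21: "x w $ P21 i j = (if j = None then g w i else 0)" for i j by (simp add: x_def)
  have ret: "x w $ Pret_passive i = w $ Norm_passive i - g w i"
    "x w $ Pret_active k = w $ Norm_active k - f w k" for i k by (simp_all add: x_def)
  have "lhs d (x w) e = w $ e" for e
    by (cases e) (simp_all add: x11 x12 x21 ret f_def g_def N)
  then show "A_mat d *v x w = w" by (simp add: A_mat_mult vec_eq_iff)
qed

section \<open>The affine blocks and the relative interior of the source simplices\<close>

lemma affine_source_block: "affine (source_block d)"
proof -
  have "lhs d (u *\<^sub>R x + v *\<^sub>R y) e = u * lhs d x e + v * lhs d y e" for u v x y e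
  proof -
    have "(\<chi> e. lhs d (u *\<^sub>R x + v *\<^sub>R y) e) = u *\<^sub>R (\<chi> e. lhs d x e) + v *\<^sub>R (\<chi> e. lhs d y e)"
      by (simp only: linear_add[OF linear_lhs] linear_scale[OF linear_lhs])
    then show ?thesis by (simp add: vec_eq_iff)
  qed
  then show ?thesis by (simp add: affine_def source_block_def del: lhs.simps)
qed

lemma affine_target_block:
  fixes d :: "'n::finite cluster_data"
  shows "affine (target_block d)"
proof -
  have lin: "u * c + v * c = c" if "u + v = 1" for u v c :: real
    using that by (simp flip: distrib_right)
  define F where "F x i = (\<Sum>j\<in>UNIV. N2 d (Some j) * x $ P21 (Some j) (Some i))
      + Neff d * x $ P21 None (Some i)
      + (\<Sum>j\<in>UNIV - {i}. N1 d j * x $ P11 j (Some i)) + N1 d i * x $ Pret_active i"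
    for x :: "real ^ 'n component" and i
  define G where "G x i = N1 d i * x $ P12 i + N2 d (Some i) * x $ Pret_passive (Some i)"
    for x :: "real ^ 'n component" and i
  define H where "H x = Neff d * x $ Pret_passive None" for x :: "real ^ 'n component"
  have "F (u *\<^sub>R x + v *\<^sub>R y) i = u * F x i + v * F y i"
    "G (u *\<^sub>R x + v *\<^sub>R y) i = u * G x i + v * G y i"
    "H (u *\<^sub>R x + v *\<^sub>R y) = u * H x + v * H y" for u v x y i
    by (simp_all add: F_def G_def H_def sum.distrib sum_distrib_left algebra_simps)
  moreover have "target_block d
      = {x. (\<forall>i. F x i = N1' d i) \<and> (\<forall>i. G x i = N2' d (Some i)) \<and> H x = N2' d None}"
    by (simp add: target_block_def F_def G_def H_def)
  ultimately show ?thesis by (simp add: affine_def lin)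
qed

lemma affine_M_set: "affine (M_set d)"
  unfolding source_Int_target[symmetric]
  by (intro affine_Int affine_source_block affine_target_block)

lemma M_set_subset_source_block: "M_set d \<subseteq> source_block d"
  using source_Int_target by blast

text \<open>The segment from a positive point \<open>p\<close> to \<open>x\<close> can be prolonged
  beyond \<open>x\<close> inside \<open>Delta d\<close>; if \<open>x $ j\<close> were 0, coordinate
  \<open>j\<close> would become negative there.\<close>

lemma rel_interior_Delta_positive:
  fixes d :: "'n::finite cluster_data"
  assumes x: "x \<in> rel_interior (Delta d)"
  shows "0 < x $ j"
proof -
  \<comment> \<open>Each normalisation equation has n + 2 summands, so the uniform vector with this
    value satisfies all of them.\<close>
  define c where "c = 1 / (real CARD('n) + 2)"
  define p where "p = (\<chi> j :: 'n component. c)"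
  have c: "0 < c" by (simp add: c_def add_nonneg_pos)
  have "lhs d p (Norm_active i) = 1" "lhs d p (Norm_passive k) = 1" for i k
    by (simp_all add: p_def card_Diff_singleton c_def field_simps)
  then have p: "p \<in> Delta d"
    using c by (simp add: Delta_def source_block_def nonneg_def p_def del: lhs.simps)
  have conv: "convex (Delta d)"
    unfolding Delta_def by (intro convex_Int convex_nonneg affine_imp_convex affine_source_block)
  then obtain e where e: "1 < e" "(1 - e) *\<^sub>R p + e *\<^sub>R x \<in> Delta d"
    using convex_rel_interior_iff[of "Delta d" x] x p by blast
  then have "0 \<le> (1 - e) * c + e * x $ j" by (auto simp: Delta_def nonneg_def p_def)
  moreover have "(1 - e) * c < 0" using e(1) c by (simp add: mult_neg_pos)
  ultimately have "0 < e * x $ j" by linarith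
  then show ?thesis using e(1) by (simp add: zero_less_mult_iff)
qed

section \<open>Total mass and entropy\<close>

text \<open>Grouping the components by source makes each group the left side of one normalisation
  equation.\<close>

lemma sum_UNIV_component:
  fixes f :: "'n::finite component \<Rightarrow> real"
  shows "(\<Sum>c\<in>UNIV. f c) = (\<Sum>i\<in>UNIV. f (P12 i) + (\<Sum>j\<in>UNIV - {Some i}. f (P11 i j)) + f (Pret_active i))
    + (\<Sum>i\<in>UNIV. (\<Sum>j\<in>UNIV. f (P21 i j)) + f (Pret_passive i))"
proof -
  have inj: "inj P11_move" "inj P12" "inj (\<lambda>p. P21 (fst p) (snd p))" "inj Pret_passive" "inj Pret_active"
    by (auto simp: inj_on_def prod_eq_iff)
  have "(\<Sum>c\<in>UNIV. f c) = (\<Sum>m\<in>UNIV. f (P11_move m)) + (\<Sum>i\<in>UNIV. f (P12 i))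
      + (\<Sum>(i, j)\<in>UNIV. f (P21 i j)) + (\<Sum>i\<in>UNIV. f (Pret_passive i)) + (\<Sum>i\<in>UNIV. f (Pret_active i))"
    unfolding UNIV_component case_prod_unfold
    by (subst sum.union_disjoint, (simp; fail), (simp; fail), (force; fail))+
      (simp only: sum.reindex[OF inj(1)] sum.reindex[OF inj(2)] sum.reindex[OF inj(3)]
        sum.reindex[OF inj(4)] sum.reindex[OF inj(5)] o_def)
  also have "(\<Sum>m\<in>UNIV. f (P11_move m)) = (\<Sum>(i, j)\<in>(SIGMA i:UNIV. UNIV - {Some i}). f (P11 i j))"
  proof (rule sum.reindex_bij_witness[where i = Abs_move and j = Rep_move])
    fix m :: "'n move" and q :: "'n \<times> 'n option"
    show "Rep_move m \<in> (SIGMA i:UNIV. UNIV - {Some i})"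
      using Rep_move[of m] by auto
    show "Abs_move (Rep_move m) = m" by (rule Rep_move_inverse)
    show "(case Rep_move m of (i, j) \<Rightarrow> f (P11 i j)) = f (P11_move m)"
      by (simp add: case_prod_unfold Rep_move_inverse)
    show "Rep_move (Abs_move q) = q" if "q \<in> (SIGMA i:UNIV. UNIV - {Some i})"
      using that by (intro Abs_move_inverse) auto
  qed simp
  also have "\<dots> = (\<Sum>i\<in>UNIV. \<Sum>j\<in>UNIV - {Some i}. f (P11 i j))"
    by (rule sum.Sigma[symmetric]) auto
  also have "(\<Sum>(i, j)\<in>UNIV. f (P21 i j)) = (\<Sum>i\<in>UNIV. \<Sum>j\<in>UNIV. f (P21 i j))"
    by (simp add: sum.cartesian_product)
  finally show ?thesis by (simp add: sum.distrib)
qed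

lemma sum_source_block:
  fixes d :: "'n::finite cluster_data"
  assumes "x \<in> source_block d"
  shows "(\<Sum>j\<in>UNIV. x $ j) = 2 * real CARD('n) + 1"
  using assms unfolding sum_UNIV_component source_block_def by simp

text \<open>For a uniform reference the logarithm of \<open>y\<close> contributes only a multiple of
  the total mass. That mass is constant on \<open>source_block\<close>, so maximising entropy there
  amounts to minimising the divergence.\<close>

lemma entropy_eq_I_div:
  fixes x y :: "real ^ 'k::finite"
  assumes c: "0 < c" and y: "\<And>j. y $ j = c" and x: "x \<in> nonneg"
  shows "entropy x = - I_div x y + real CARD('k) * c - (1 + ln c) * (\<Sum>j\<in>UNIV. x $ j)"
proof -
  have "x $ j * ln (x $ j / y $ j) - x $ j + y $ j = x $ j * ln (x $ j) + c - (1 + ln c) * x $ j" for j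
  proof (cases "x $ j = 0")
    case False
    then have "0 < x $ j" using x by (simp add: nonneg_def order_less_le)
    then show ?thesis using c by (simp add: y ln_div algebra_simps)
  qed (simp add: y)
  then show ?thesis
    by (simp add: I_div_def entropy_def sum.distrib sum_subtractf sum_distrib_left)
qed

lemma unique_arg_max_uminus:
  fixes f g :: "'a \<Rightarrow> real"
  assumes "unique_arg_min f K x" "\<And>z. z \<in> K \<Longrightarrow> g z = C - f z"
  shows "unique_arg_max g K x"
proof -
  have "is_arg_max g (\<lambda>z. z \<in> K) z \<longleftrightarrow> is_arg_min f (\<lambda>z. z \<in> K) z" for z
    unfolding is_arg_max_def is_arg_min_def using assms(2) by auto
  then show ?thesis using assms(1) by (simp add: unique_arg_min_def unique_arg_max_def)
qed

text \<open>Both orders of the two blocks are covered. Positivity of the iterates is asserted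
  because \<open>I_div\<close> is the intended divergence only for a positive second
  argument.\<close>

theorem theorem2:
  fixes d :: "'n::finite cluster_data" and xbar :: "real ^ 'n component"
  assumes "valid_data d"
  shows
    "(invertible (A_mat d ** transpose (A_mat d)) \<and>
      (let x = xbar - transpose (A_mat d) *v
                 (matrix_inv (A_mat d ** transpose (A_mat d)) *v (A_mat d *v xbar - b_vec d))
       in unique_arg_min (\<lambda>z. euclid_div z xbar) (M_set d) x \<and>
          orthogonal_projection (M_set d) xbar x \<and>
          (xbar = 0 \<longrightarrow>
             unique_arg_min norm (M_set d) x \<and>
             (x \<in> nonneg \<longrightarrow> unique_arg_min norm (M_set d \<inter> nonneg) x)) \<and>
          bregman_projection (bregman_divergence (\<lambda>z. (norm z)\<^sup>2)) (M_set d) xbar x))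
     \<and>
     ((\<forall>j. 0 < xbar $ j) \<and> M_set d \<inter> nonneg \<noteq> {} \<longrightarrow>
      (\<exists>x. unique_arg_min (\<lambda>z. I_div z xbar) (M_set d \<inter> nonneg) x \<and>
           (M_set d \<inter> rel_interior (Delta d) \<noteq> {} \<longrightarrow>
              (\<exists>\<nu> :: real ^ 'n equation.
                 \<forall>j. x $ j = xbar $ j * exp ((transpose (A_mat d) *v \<nu>) $ j)) \<and>
              (\<forall>Ks \<in> {[source_block d \<inter> nonneg, target_block d \<inter> nonneg],
                      [target_block d \<inter> nonneg, source_block d \<inter> nonneg]}.
                 \<exists>X. cyclic_projections I_div Ks xbar X \<and> (\<forall>k j. 0 < X k $ j) \<and>
                     X \<longlonglongrightarrow> x)) \<and>
           ((\<exists>c. \<forall>j. xbar $ j = c) \<longrightarrow>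
              unique_arg_max entropy (M_set d \<inter> nonneg) x) \<and>
           bregman_projection (bregman_divergence neg_entropy) (M_set d \<inter> nonneg) xbar x))"
proof -
  have inv: "invertible (A_mat d ** transpose (A_mat d))"
    by (intro gram_invertible surj_A_mat assms)
  show ?thesis
  proof (intro conjI impI)
    show "invertible (A_mat d ** transpose (A_mat d))" by (rule inv)
    define x where "x = xbar - transpose (A_mat d) *v
        (matrix_inv (A_mat d ** transpose (A_mat d)) *v (A_mat d *v xbar - b_vec d))"
    have proj: "orthogonal_projection (M_set d) xbar x"
      unfolding M_set_def x_def by (rule orthogonal_projection_gram[OF inv])
    then have min: "unique_arg_min (\<lambda>z. (norm (z - xbar))\<^sup>2) (M_set d) x"
      by (rule orthogonal_projection_unique_arg_min)
    have min0: "unique_arg_min norm (M_set d) x" if "xbar = 0"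
      using min unfolding that unique_arg_min_def is_arg_min_linorder by simp
    have "unique_arg_min norm (M_set d \<inter> nonneg) x" if "xbar = 0" "x \<in> nonneg"
      using min0[OF that(1)] that(2)
      by (intro unique_arg_minI)
        (auto intro: unique_arg_min_mem unique_arg_min_le unique_arg_min_eq)
    then show "let x = xbar - transpose (A_mat d) *v
               (matrix_inv (A_mat d ** transpose (A_mat d)) *v (A_mat d *v xbar - b_vec d))
         in unique_arg_min (\<lambda>z. euclid_div z xbar) (M_set d) x \<and>
            orthogonal_projection (M_set d) xbar x \<and>
            (xbar = 0 \<longrightarrow>
               unique_arg_min norm (M_set d) x \<and>
               (x \<in> nonneg \<longrightarrow> unique_arg_min norm (M_set d \<inter> nonneg) x)) \<and>
            bregman_projection (bregman_divergence (\<lambda>z. (norm z)\<^sup>2)) (M_set d) xbar x"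
      unfolding Let_def x_def[symmetric] bregman_projection_def bregman_divergence_norm_power2
        euclid_div_def
      using proj min min0 by blast
  next
    assume "(\<forall>j. 0 < xbar $ j) \<and> M_set d \<inter> nonneg \<noteq> {}"
    then have pos: "\<And>j. 0 < xbar $ j" and ne: "M_set d \<inter> nonneg \<noteq> {}" by auto
    have conv: "convex (M_set d \<inter> nonneg)"
      by (intro convex_Int convex_nonneg affine_imp_convex affine_M_set)
    have "closed (M_set d \<inter> nonneg)"
      by (intro closed_Int affine_closed affine_M_set closed_nonneg)
    then obtain x where x: "bregman_projection I_div (M_set d \<inter> nonneg) xbar x"
      using I_projection_exists[where y=xbar, OF pos _ conv _ ne] by blast
    then have min: "unique_arg_min (\<lambda>z. I_div z xbar) (M_set d \<inter> nonneg) x"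
      by (simp add: bregman_projection_def)
    have xM: "x \<in> M_set d" using unique_arg_min_mem[OF min] by blast
    have interior: "(\<exists>\<nu>. \<forall>j. x $ j = xbar $ j * exp ((transpose (A_mat d) *v \<nu>) $ j)) \<and>
        (\<forall>Ks \<in> {[source_block d \<inter> nonneg, target_block d \<inter> nonneg],
                [target_block d \<inter> nonneg, source_block d \<inter> nonneg]}.
           \<exists>X. cyclic_projections I_div Ks xbar X \<and> (\<forall>k j. 0 < X k $ j) \<and> X \<longlonglongrightarrow> x)"
      if M: "M_set d \<inter> rel_interior (Delta d) \<noteq> {}"
    proof
      obtain p where p: "p \<in> M_set d" "\<And>j. 0 < p $ j"
        using M rel_interior_Delta_positive by blast
      have pM: "p \<in> M_set d \<inter> nonneg" using p by (simp add: nonneg_def less_imp_le)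
      have xpos: "0 < x $ j" for j
        using I_projection_positive[where y=xbar, OF pos conv _ pM p(2) x] by simp
      define w where "w = (\<chi> j. ln (x $ j / xbar $ j))"
      have "inner w h = 0" if "A_mat d *v h = 0" for h
      proof -
        \<comment> \<open>Kernel vectors are the directions of \<open>M_set d\<close>, so
          stationarity makes \<open>w\<close> orthogonal to the kernel.\<close>
        have "x + h \<in> M_set d"
          using xM that by (simp add: M_set_def matrix_vector_right_distrib)
        then have "(\<Sum>j\<in>UNIV. ((x + h) $ j - x $ j) * ln (x $ j / xbar $ j)) = 0"
          by (intro I_projection_stationary[OF pos affine_M_set _ x xpos])
        then show ?thesis by (simp add: inner_vec_def w_def mult.commute)
      qed
      then obtain \<nu> where \<nu>: "w = transpose (A_mat d) *v \<nu>"
        using orthogonal_kernel_imp_range_transpose[OF inv] by blast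
      have "x $ j = xbar $ j * exp (w $ j)" for j
        using xpos[of j] pos[of j] by (simp add: w_def)
      then show "\<exists>\<nu>. \<forall>j. x $ j = xbar $ j * exp ((transpose (A_mat d) *v \<nu>) $ j)"
        using \<nu> by blast
      have "\<exists>X. cyclic_projections I_div (map (\<lambda>B. B \<inter> nonneg) Bs) xbar X \<and>
          (\<forall>k j. 0 < X k $ j) \<and> X \<longlonglongrightarrow> x"
        if Bs: "set Bs = {source_block d, target_block d}" for Bs
      proof (rule cyclic_I_projections_converge)
        have Int: "\<Inter> (set Bs) = M_set d" by (simp add: Bs source_Int_target)
        show "p \<in> \<Inter> (set Bs)" "bregman_projection I_div (\<Inter> (set Bs) \<inter> nonneg) xbar x"
          unfolding Int by (rule p x)+
        show "affine B" if "B \<in> set Bs" for B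
          using that affine_source_block affine_target_block by (auto simp: Bs)
      qed (use pos p Bs in auto)
      from this[of "[source_block d, target_block d]"] this[of "[target_block d, source_block d]"]
      show "\<forall>Ks \<in> {[source_block d \<inter> nonneg, target_block d \<inter> nonneg],
                [target_block d \<inter> nonneg, source_block d \<inter> nonneg]}.
           \<exists>X. cyclic_projections I_div Ks xbar X \<and> (\<forall>k j. 0 < X k $ j) \<and> X \<longlonglongrightarrow> x"
        by (simp add: insert_commute)
    qed
    have uniform: "unique_arg_max entropy (M_set d \<inter> nonneg) x" if unif: "\<exists>c. \<forall>j. xbar $ j = c"
    proof -
      obtain c where c: "\<And>j. xbar $ j = c" using unif by blast
      \<comment> \<open>Any component would serve as the witness here.\<close>
      have "0 < c" using pos[of "P12 undefined"] c by simp
      have "entropy z = real CARD('n component) * c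
          - (1 + ln c) * (2 * real CARD('n) + 1) - I_div z xbar"
        if "z \<in> M_set d \<inter> nonneg" for z
      proof -
        have z: "z \<in> source_block d" "z \<in> nonneg"
          using that M_set_subset_source_block by auto
        show ?thesis
          using entropy_eq_I_div[where x=z and y=xbar, OF \<open>0 < c\<close> c z(2)]
          unfolding sum_source_block[OF z(1)] by linarith
      qed
      then show ?thesis by (rule unique_arg_max_uminus[OF min])
    qed
    \<comment> \<open>The two divergences are identified on \<open>nonneg\<close>, which contains
      the feasible set.\<close>
    have "bregman_projection (bregman_divergence neg_entropy) (M_set d \<inter> nonneg) xbar x"
      using min unfolding bregman_projection_def
      by (subst unique_arg_min_cong[where g = "\<lambda>z. I_div z xbar"])
        (auto intro!: bregman_divergence_neg_entropy pos)
    then show "\<exists>x. unique_arg_min (\<lambda>z. I_div z xbar) (M_set d \<inter> nonneg) x \<and>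
             (M_set d \<inter> rel_interior (Delta d) \<noteq> {} \<longrightarrow>
                (\<exists>\<nu> :: real ^ 'n equation.
                   \<forall>j. x $ j = xbar $ j * exp ((transpose (A_mat d) *v \<nu>) $ j)) \<and>
                (\<forall>Ks \<in> {[source_block d \<inter> nonneg, target_block d \<inter> nonneg],
                        [target_block d \<inter> nonneg, source_block d \<inter> nonneg]}.
                   \<exists>X. cyclic_projections I_div Ks xbar X \<and> (\<forall>k j. 0 < X k $ j) \<and>
                       X \<longlonglongrightarrow> x)) \<and>
             ((\<exists>c. \<forall>j. xbar $ j = c) \<longrightarrow>
                unique_arg_max entropy (M_set d \<inter> nonneg) x) \<and>
             bregman_projection (bregman_divergence neg_entropy) (M_set d \<inter> nonneg) xbar x"
      using min interior uniform by blast
  qed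
qed

end
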